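(* Let $T \in \mathbb{N}$ and let $0 \le \gamma_{\max} \le 1$. Let $\mathcal{M}_1(\gamma_{\max})$ be the set of all $2$-armed deterministic rested bandits $\boldsymbol{\mu} = (\mu_1,\mu_2)$ whose expected reward functions are non-decreasing and satisfy $\gamma_i(n) \le \gamma_{\max}$ for all $i \in \{1,2\}$ and $n \in \mathbb{N}$. Then, for every learning policy $\pi$, $$\sup_{\boldsymbol{\mu} \in \mathcal{M}_1(\gamma_{\max})} R_{\boldsymbol{\mu}}(\pi, T) \ge \left\lfloor \frac{\gamma_{\max}}{12}\, T \right\rfloor .$$
   Context: Setting: $\mathbb{N} = \{1,2,\dots\}$, $[K] = \{1,\dots,K\}$. A deterministic rested $K$-armed bandit is a vector $\boldsymbol{\mu} = (\mu_i)_{i\in[K]}$ of functions $\mu_i : \mathbb{N} \to [0,1]$. At each round $t \in [T]$ the agent selects an arm $I_t \in [K]$ and observes the reward $R_t = \mu_{I_t}(N_{I_t,t})$, where $N_{i,t} = \sum_{l=1}^t \mathbf{1}\{I_l = i\}$ is the number of pulls of arm $i$ up to and including round $t$ (so the reward of an arm depends on how many times that arm has been pulled). A learning policy $\pi$ is a function mapping each history $\mathcal{H}_{t-1} = (I_l,R_l)_{l=1}^{t-1}$ to an arm $I_t$ (it may depend on $T$). Its expected cumulative reward is $J_{\boldsymbol{\mu}}(\pi,T) = \mathbb{E}_{\boldsymbol{\mu},\pi}\big[\sum_{t=1}^T \mu_{I_t}(N_{I_t,t})\big]$, and its expected cumulative regret is $R_{\boldsymbol{\mu}}(\pi,T) =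 \sup_{\pi'} J_{\boldsymbol{\mu}}(\pi',T) - J_{\boldsymbol{\mu}}(\pi,T)$, where $\pi'$ ranges over all policies (including those that know $\boldsymbol{\mu}$). Increments: $\gamma_i(n) = \mu_i(n+1) - \mu_i(n)$. Non-decreasing means $\gamma_i(n) \ge 0$ for all $i \in [K]$ and $n \in \mathbb{N}$. *)

theory Defs
  imports Complex_Main
begin

text \<open>
  Arms are the elements of \<open>{1..K}\<close> and pulls are counted from 1: \<open>\<mu> i n\<close> is the reward of
  the \<open>n\<close>-th pull of arm \<open>i\<close>, and is irrelevant for \<open>n = 0\<close> or \<open>i \<notin> {1..K}\<close>.
\<close>

type_synonym bandit = "nat \<Rightarrow> nat \<Rightarrow> real"

type_synonym history = "(nat \<times> real) list"

type_synonym policy = "history \<Rightarrow> nat"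

definition bandits :: "nat \<Rightarrow> bandit set" where
  "bandits K = {\<mu>. \<forall>i\<in>{1..K}. \<forall>n\<ge>1. \<mu> i n \<in> {0..1}}"

definition increment :: "bandit \<Rightarrow> nat \<Rightarrow> nat \<Rightarrow> real" where
  "increment \<mu> i n = \<mu> i (n + 1) - \<mu> i n"

text \<open>A history lists the pairs (arm, reward) in chronological order, the first round at the head.\<close>

definition policies :: "nat \<Rightarrow> policy set" where
  "policies K = {\<pi>. \<forall>h. set h \<subseteq> {1..K} \<times> {0..1} \<longrightarrow> \<pi> h \<in> {1..K}}"

primrec history :: "bandit \<Rightarrow> policy \<Rightarrow> nat \<Rightarrow> history" where
  "history \<mu> \<pi> 0 = []"
| "history \<mu> \<pi> (Suc t) =
     (let h = history \<mu> \<pi> t; i = \<pi> h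
      in h @ [(i, \<mu> i (length (filter (\<lambda>x. fst x = i) h) + 1))])"

definition chosen_arm :: "bandit \<Rightarrow> policy \<Rightarrow> nat \<Rightarrow> nat" where
  "chosen_arm \<mu> \<pi> t = \<pi> (history \<mu> \<pi> (t - 1))"

definition pulls :: "bandit \<Rightarrow> policy \<Rightarrow> nat \<Rightarrow> nat \<Rightarrow> nat" where
  "pulls \<mu> \<pi> i t = card {l \<in> {1..t}. chosen_arm \<mu> \<pi> l = i}"

text \<open>
  Rewards are deterministic and a policy is a function of the history, so the law of the
  trajectory is a point mass and the expected cumulative reward is the cumulative reward
  along that single trajectory.
\<close>

definition cumulative_reward :: "bandit \<Rightarrow> policy \<Rightarrow> nat \<Rightarrow> real" where
  "cumulative_reward \<mu> \<pi> T =
     (\<Sum>t = 1..T. \<mu> (chosen_arm \<mu> \<pi> t) (pulls \<mu> \<pi> (chosen_arm \<mu> \<pi> t) t))"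

text \<open>
  The comparator \<open>\<pi>'\<close> is chosen after \<open>\<mu>\<close>, so it may depend on \<open>\<mu>\<close>. For a bandit in
  \<open>bandits K\<close> the supremum is over a nonempty bounded set if \<open>K \<ge> 1\<close>.
\<close>

definition regret :: "nat \<Rightarrow> bandit \<Rightarrow> policy \<Rightarrow> nat \<Rightarrow> real" where
  "regret K \<mu> \<pi> T =
     (SUP \<pi>'\<in>policies K. cumulative_reward \<mu> \<pi>' T) - cumulative_reward \<mu> \<pi> T"

definition M1 :: "real \<Rightarrow> bandit set" where
  "M1 \<gamma>max = {\<mu> \<in> bandits 2.
     (\<forall>i\<in>{1..2}. \<forall>n\<ge>1. increment \<mu> i n \<ge> 0) \<and>
     (\<forall>i\<in>{1..2}. \<forall>n\<ge>1. increment \<mu> i n \<le> \<gamma>max)}"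

lemma pulls_Suc:
  "pulls \<mu> \<pi> i (Suc t) = pulls \<mu> \<pi> i t + (if chosen_arm \<mu> \<pi> (Suc t) = i then 1 else 0)"
proof -
  have "{l \<in> {1..Suc t}. chosen_arm \<mu> \<pi> l = i} =
    (if chosen_arm \<mu> \<pi> (Suc t) = i then insert (Suc t) {l \<in> {1..t}. chosen_arm \<mu> \<pi> l = i}
     else {l \<in> {1..t}. chosen_arm \<mu> \<pi> l = i})"
    by (auto simp: le_Suc_eq)
  then show ?thesis by (simp add: pulls_def)
qed

lemma pulls_history:
  "length (filter (\<lambda>x. fst x = i) (history \<mu> \<pi> t)) = pulls \<mu> \<pi> i t"
proof (induction t)
  case 0
  show ?case by (simp add: pulls_def)
next
  case (Suc t)
  then show ?case by (simp add: pulls_Suc Let_def chosen_arm_def)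
qed

text \<open>The recorded reward of round \<open>t\<close> is \<open>\<mu>\<close> at the chosen arm and its number of pulls up to and
  including \<open>t\<close>.\<close>

lemma history_eq:
  "history \<mu> \<pi> t =
     map (\<lambda>l. (chosen_arm \<mu> \<pi> l, \<mu> (chosen_arm \<mu> \<pi> l) (pulls \<mu> \<pi> (chosen_arm \<mu> \<pi> l) l))) [1..<t + 1]"
proof (induction t)
  case 0
  show ?case by simp
next
  case (Suc t)
  have "history \<mu> \<pi> (Suc t) = history \<mu> \<pi> t @
     [(chosen_arm \<mu> \<pi> (Suc t), \<mu> (chosen_arm \<mu> \<pi> (Suc t)) (pulls \<mu> \<pi> (chosen_arm \<mu> \<pi> (Suc t)) (Suc t)))]"
    by (simp add: Let_def pulls_history pulls_Suc) (simp add: chosen_arm_def)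
  then show ?case using Suc by simp
qed

lemma history_valid:
  assumes "\<mu> \<in> bandits K" "\<pi> \<in> policies K"
  shows "set (history \<mu> \<pi> t) \<subseteq> {1..K} \<times> {0..1}"
proof (induction t)
  case 0
  show ?case by simp
next
  case (Suc t)
  then have "\<pi> (history \<mu> \<pi> t) \<in> {1..K}" using assms(2) by (auto simp: policies_def)
  moreover from this assms(1) have "\<mu> (\<pi> (history \<mu> \<pi> t)) (n + 1) \<in> {0..1}" for n
    unfolding bandits_def by (simp add: Ball_def)
  ultimately show ?case using Suc by (simp add: Let_def)
qed

lemma cumulative_reward_bounds:
  assumes "\<mu> \<in> bandits K" "\<pi> \<in> policies K"
  shows "cumulative_reward \<mu> \<pi> T \<in> {0..real T}"
proof -
  have *: "\<mu> (chosen_arm \<mu> \<pi> t) (pulls \<mu> \<pi> (chosen_arm \<mu> \<pi> t) t) \<in> {0..1}" if "t \<in> {1..T}" for t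
  proof -
    have "(chosen_arm \<mu> \<pi> t, \<mu> (chosen_arm \<mu> \<pi> t) (pulls \<mu> \<pi> (chosen_arm \<mu> \<pi> t) t))
        \<in> set (history \<mu> \<pi> T)"
      unfolding history_eq set_map by (rule image_eqI[OF refl]) (use that in auto)
    with history_valid[OF assms, of T] show ?thesis by blast
  qed
  have "cumulative_reward \<mu> \<pi> T \<le> (\<Sum>t = 1..T. 1)"
    unfolding cumulative_reward_def using * by (intro sum_mono) auto
  moreover have "cumulative_reward \<mu> \<pi> T \<ge> 0"
    unfolding cumulative_reward_def using * by (intro sum_nonneg) auto
  ultimately show ?thesis by simp
qed

lemma bdd_above_cumulative_reward:
  assumes "\<mu> \<in> bandits K"
  shows "bdd_above ((\<lambda>\<pi>. cumulative_reward \<mu> \<pi> T) ` policies K)"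
  using cumulative_reward_bounds[OF assms] by (intro bdd_aboveI2[where M = "real T"]) auto

lemma regret_bounds:
  assumes "\<mu> \<in> bandits K" "\<pi> \<in> policies K"
  shows "regret K \<mu> \<pi> T \<in> {0..real T}"
proof -
  have "(SUP \<pi>'\<in>policies K. cumulative_reward \<mu> \<pi>' T) \<le> real T"
    using assms cumulative_reward_bounds[OF assms(1)] by (intro cSUP_least) auto
  moreover have "cumulative_reward \<mu> \<pi> T \<le> (SUP \<pi>'\<in>policies K. cumulative_reward \<mu> \<pi>' T)"
    using assms bdd_above_cumulative_reward by (intro cSUP_upper)
  ultimately show ?thesis
    using cumulative_reward_bounds[OF assms, of T] by (simp add: regret_def)
qed

text \<open>The real-valued supremum over \<open>M1 \<gamma>max\<close> is a genuine one: the set is nonempty if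
  \<open>\<gamma>max \<ge> 0\<close> (constant bandits) and the regrets are bounded.\<close>

lemma M1_nonempty:
  assumes "0 \<le> \<gamma>max"
  shows "(\<lambda>i n. 0) \<in> M1 \<gamma>max"
  using assms by (simp add: M1_def bandits_def increment_def)

lemma bdd_above_regret_M1:
  assumes "\<pi> \<in> policies 2"
  shows "bdd_above ((\<lambda>\<mu>. regret 2 \<mu> \<pi> T) ` M1 \<gamma>max)"
  using regret_bounds[OF _ assms] by (intro bdd_aboveI2[where M = "real T"]) (auto simp: M1_def)

end

theory Submission
  imports Defs
begin

text \<open>
  If \<open>\<gamma>max * T < 12\<close> the bound is \<open>0\<close>. Otherwise let arm 1 pay \<open>1/2\<close> forever and let arm 2 pay
  \<open>0\<close>; if the policy pulls arm 2 at least \<open>T/6\<close> times, its regret is at least \<open>T/12\<close>. If it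
  pulls arm 2 only \<open>N < T/6\<close> times, let arm 2 instead start rising with slope \<open>\<gamma>max\<close> right after
  the \<open>N\<close>-th pull: the policy sees the same history and collects at most \<open>T/2\<close>, whereas always
  pulling arm 2 yields reward \<open>1\<close> from pull \<open>N + 1/\<gamma>max \<le> T/4\<close> on, hence at least \<open>3T/4\<close>.
\<close>

text \<open>The truncated subtraction makes arm 2 pay \<open>0\<close> during its first \<open>m\<close> pulls.\<close>

definition ramp :: "real \<Rightarrow> nat \<Rightarrow> bandit" where
  "ramp \<gamma> m = (\<lambda>i n. if i = 1 then 1/2 else min 1 (\<gamma> * real (n - m)))"

lemma ramp_in_M1:
  assumes "0 \<le> \<gamma>" "\<gamma> \<le> \<gamma>max"
  shows "ramp \<gamma> m \<in> M1 \<gamma>max"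
proof -
  \<comment> \<open>Up to pull \<open>m\<close> both terms are 0; afterwards the uncapped value
    grows by exactly \<gamma>, and capping at 1 can only shrink a nonnegative step.\<close>
  have step: "min 1 (\<gamma> * real (Suc n - m)) - min 1 (\<gamma> * real (n - m)) \<in> {0..\<gamma>max}" for n
  proof (cases "n < m")
    case True
    then show ?thesis using assms by (auto simp: Suc_diff_le)
  next
    case False
    then have "\<gamma> * real (Suc n - m) = \<gamma> * real (n - m) + \<gamma>"
      by (simp add: Suc_diff_le algebra_simps)
    then show ?thesis using assms by auto
  qed
  show ?thesis
    using assms step by (auto simp: M1_def bandits_def increment_def ramp_def)
qed

text \<open>Makes the total depend on the history alone, so bandits that the policy cannot tell
  apart give it the same reward.\<close>

lemma cumulative_reward_eq_sum_list:
  "cumulative_reward \<mu> \<pi> T = sum_list (map snd (history \<mu> \<pi> T))"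
  unfolding cumulative_reward_def history_eq
  by (simp add: o_def interv_sum_list_conv_sum_set_nat atLeastLessThanSuc_atLeastAtMost
      del: upt_Suc)

lemma cumulative_reward_constant_policy:
  "cumulative_reward \<mu> (\<lambda>_. k) T = (\<Sum>t = 1..T. \<mu> k t)"
proof -
  have "pulls \<mu> (\<lambda>_. k) k t = t" for t
    by (induction t) (simp_all add: pulls_Suc chosen_arm_def, simp add: pulls_def)
  then show ?thesis by (simp add: cumulative_reward_def chosen_arm_def)
qed

lemma regret_ge_constant_policy:
  assumes "\<mu> \<in> bandits K" "k \<in> {1..K}"
  shows "regret K \<mu> \<pi> T \<ge> (\<Sum>t = 1..T. \<mu> k t) - cumulative_reward \<mu> \<pi> T"
proof -
  have "(\<lambda>_. k) \<in> policies K" using assms(2) by (simp add: policies_def)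
  then have "cumulative_reward \<mu> (\<lambda>_. k) T \<le> (SUP \<pi>'\<in>policies K. cumulative_reward \<mu> \<pi>' T)"
    by (rule cSUP_upper) (rule bdd_above_cumulative_reward[OF assms(1)])
  then show ?thesis by (simp add: regret_def cumulative_reward_constant_policy)
qed

lemma pulls_mono: "s \<le> t \<Longrightarrow> pulls \<mu> \<pi> i s \<le> pulls \<mu> \<pi> i t"
  unfolding pulls_def by (rule card_mono) auto

lemma chosen_arm_mem:
  assumes "\<mu> \<in> bandits K" "\<pi> \<in> policies K"
  shows "chosen_arm \<mu> \<pi> t \<in> {1..K}"
  using assms(2) history_valid[OF assms] unfolding chosen_arm_def policies_def by blast

text \<open>Slope 0 makes arm 2 worthless for every \<open>m\<close>, so each pull of it forfeits
  1/2.\<close>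

lemma cumulative_reward_flat:
  assumes "\<pi> \<in> policies 2"
  shows "cumulative_reward (ramp 0 m) \<pi> T = real T / 2 - real (pulls (ramp 0 m) \<pi> 2 T) / 2"
proof (induction T)
  case 0
  show ?case by (simp add: cumulative_reward_def pulls_def)
next
  case (Suc T)
  have "ramp 0 m \<in> bandits 2" using ramp_in_M1[of 0 0 m] by (simp add: M1_def)
  from chosen_arm_mem[OF this assms, of "Suc T"]
  have "chosen_arm (ramp 0 m) \<pi> (Suc T) = 1 \<or> chosen_arm (ramp 0 m) \<pi> (Suc T) = 2"
    by auto
  with Suc show ?case
    by (auto simp: cumulative_reward_def pulls_Suc ramp_def field_simps)
qed

text \<open>The rise begins only after as many pulls of arm 2 as the policy makes in the flat bandit
  within \<open>T\<close> rounds, so by induction it never observes a difference.\<close>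

lemma history_ramp_eq_flat:
  assumes "\<pi> \<in> policies 2" "t \<le> T"
  shows "history (ramp \<gamma> (pulls (ramp 0 0) \<pi> 2 T)) \<pi> t = history (ramp 0 0) \<pi> t"
  using assms(2)
proof (induction t)
  case 0
  show ?case by simp
next
  case (Suc t)
  let ?Z = "ramp 0 0"
  have "?Z \<in> bandits 2" using ramp_in_M1[of 0 0 0] by (simp add: M1_def)
  from chosen_arm_mem[OF this assms(1), of "Suc t"]
  have arm: "chosen_arm ?Z \<pi> (Suc t) = 1 \<or> chosen_arm ?Z \<pi> (Suc t) = 2" by auto
  \<comment> \<open>If arm 2 is chosen next, this bounds the index of that very pull, so the
    truncated subtraction in \<open>ramp\<close> still gives 0.\<close>
  have "pulls ?Z \<pi> 2 (Suc t) \<le> pulls ?Z \<pi> 2 T" using Suc.prems by (rule pulls_mono)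
  with arm have "ramp \<gamma> (pulls ?Z \<pi> 2 T) (chosen_arm ?Z \<pi> (Suc t))
        (pulls ?Z \<pi> (chosen_arm ?Z \<pi> (Suc t)) t + 1)
      = ?Z (chosen_arm ?Z \<pi> (Suc t)) (pulls ?Z \<pi> (chosen_arm ?Z \<pi> (Suc t)) t + 1)"
    by (auto simp: ramp_def pulls_Suc)
  with Suc show ?case by (simp add: Let_def pulls_history chosen_arm_def)
qed

lemma sum_ramp_ge:
  assumes "0 < \<gamma>" "real m + 1 / \<gamma> \<le> c" "0 \<le> c"
  shows "(\<Sum>t = 1..T. ramp \<gamma> m 2 t) \<ge> real T - c"
proof -
  have ge: "ramp \<gamma> m 2 t \<ge> (if c \<le> real t then 1 else 0)" for t
  proof (cases "c \<le> real t")
    case True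
    \<comment> \<open>Positivity forces \<open>m < t\<close>, so \<open>t - m\<close> is not
      truncated.\<close>
    have "0 < 1 / \<gamma>" using assms(1) by simp
    then have "1 / \<gamma> \<le> real (t - m)" using True assms(2) by (simp add: of_nat_diff)
    then have "1 \<le> \<gamma> * real (t - m)"
      using pos_divide_le_eq[OF assms(1)] by (metis mult.commute)
    with True show ?thesis by (simp add: ramp_def del: of_nat_diff)
  qed (use assms(1) in \<open>simp add: ramp_def\<close>)
  have "(\<Sum>t = 1..T. if c \<le> real t then 1 else 0) \<ge> real T - c"
  proof (induction T)
    case 0
    show ?case using assms(3) by simp
  next
    case (Suc T)
    show ?case
    proof (cases "c \<le> real (Suc T)")
      \<comment> \<open>Here \<open>T + 1 < c\<close>: the lower bound is negative, the sum is
        not.\<close>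
      case False
      have "(\<Sum>t = 1..Suc T. if c \<le> real t then 1 else 0) \<ge> (0::real)"
        by (intro sum_nonneg) auto
      with False show ?thesis by linarith
    qed (use Suc in simp)
  qed
  also have "(\<Sum>t = 1..T. if c \<le> real t then 1 else 0) \<le> (\<Sum>t = 1..T. ramp \<gamma> m 2 t)"
    by (intro sum_mono ge)
  finally show ?thesis .
qed

theorem theorem4p2:
  fixes T :: nat and \<gamma>max :: real and \<pi> :: policy
  assumes "T \<ge> 1"
    and "0 \<le> \<gamma>max" and "\<gamma>max \<le> 1"
    and "\<pi> \<in> policies 2"
  shows "(SUP \<mu>\<in>M1 \<gamma>max. regret 2 \<mu> \<pi> T) \<ge> real_of_int \<lfloor>\<gamma>max / 12 * real T\<rfloor>"
proof -
  have upper: "regret 2 \<mu> \<pi> T \<le> (SUP \<mu>\<in>M1 \<gamma>max. regret 2 \<mu> \<pi> T)" if "\<mu> \<in> M1 \<gamma>max" for \<mu>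
    using that bdd_above_regret_M1[OF assms(4)] by (rule cSUP_upper)
  show ?thesis
  proof (cases "\<gamma>max * real T < 12")
    case True
    then have "\<lfloor>\<gamma>max / 12 * real T\<rfloor> \<le> 0" by linarith
    moreover have "0 \<le> regret 2 (\<lambda>i n. 0) \<pi> T"
      using regret_bounds[OF _ assms(4)] M1_nonempty[OF assms(2)] by (simp add: M1_def)
    ultimately show ?thesis
      using upper[OF M1_nonempty[OF assms(2)]] by linarith
  next
    case False
    define N where "N = pulls (ramp 0 0) \<pi> 2 T"
    \<comment> \<open>Since \<gamma>max \<le> 1, it suffices to prove the bound
      \<open>T / 12\<close>.\<close>
    have "\<gamma>max * real T \<le> real T" using assms(3) by (simp add: mult_left_le_one_le assms(2))
    then have floor: "real_of_int \<lfloor>\<gamma>max / 12 * real T\<rfloor> \<le> real T / 12" by linarith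
    have reward: "cumulative_reward (ramp 0 0) \<pi> T = real T / 2 - real N / 2"
      using cumulative_reward_flat[OF assms(4)] by (simp add: N_def)
    have "real T / 12 \<le> (SUP \<mu>\<in>M1 \<gamma>max. regret 2 \<mu> \<pi> T)"
    proof (cases "real T / 6 \<le> real N")
      case True
      have flat: "ramp 0 0 \<in> M1 \<gamma>max" using assms(2) by (simp add: ramp_in_M1)
      then have "regret 2 (ramp 0 0) \<pi> T \<ge>
          (\<Sum>t = 1..T. ramp 0 0 1 t) - cumulative_reward (ramp 0 0) \<pi> T"
        by (intro regret_ge_constant_policy) (auto simp: M1_def)
      also have "(\<Sum>t = 1..T. ramp 0 0 1 t) = real T / 2" by (simp add: ramp_def)
      finally have "real N / 2 \<le> regret 2 (ramp 0 0) \<pi> T"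
        unfolding reward by (simp add: field_simps)
      with True upper[OF flat] show ?thesis by linarith
    next
      case few: False
      have pos: "0 < \<gamma>max" using False assms(2) by (cases "\<gamma>max = 0") auto
      have rise: "ramp \<gamma>max N \<in> M1 \<gamma>max" using assms(2) by (simp add: ramp_in_M1)
      then have "regret 2 (ramp \<gamma>max N) \<pi> T \<ge>
          (\<Sum>t = 1..T. ramp \<gamma>max N 2 t) - cumulative_reward (ramp \<gamma>max N) \<pi> T"
        by (intro regret_ge_constant_policy) (auto simp: M1_def)
      moreover have "cumulative_reward (ramp \<gamma>max N) \<pi> T = real T / 2 - real N / 2"
        using history_ramp_eq_flat[OF assms(4) order_refl] reward
        by (simp add: cumulative_reward_eq_sum_list N_def)
      \<comment> \<open>\<open>False\<close> is still the outer case, 12 \<le> \<gamma>max * T. With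
        \<open>N < T / 6\<close> it puts the cap at \<open>c = T / 6 + T / 12 = T / 4\<close>, so
        the regret is at least \<open>3 T / 4 - T / 2 = T / 4\<close>.\<close>
      moreover have "1 / \<gamma>max \<le> real T / 12"
        using False pos by (simp add: field_simps)
      then have "(\<Sum>t = 1..T. ramp \<gamma>max N 2 t) \<ge> real T - real T / 4"
        using few pos by (intro sum_ramp_ge) auto
      ultimately show ?thesis using upper[OF rise] by linarith
    qed
    with floor show ?thesis by linarith
  qed
qed

end
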